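(* Let $\mathcal{M}$ be the set of all lower semicomputable chronological contextual semimeasures. Let $\pi$ be any computable deterministic policy, let $\xi$ be any Bayesian mixture over $\mathcal{M}$, and let $\varepsilon>0$. There is a Bayesian mixture $\xi'$ over $\mathcal{M}$ such that for any history $\ae_{<t}$ that is consistent with $\pi$ and for which $V^\pi_\xi(\ae_{<t})>\varepsilon$, the action $\pi(\ae_{<t})$ is the unique $\xi'$-optimal action, i.e. $V^*_{\xi'}(\ae_{<t}\,\pi(\ae_{<t}))>V^*_{\xi'}(\ae_{<t}\,b)$ for all actions $b\ne\pi(\ae_{<t})$.
   Context: The action set $\mathcal{A}$ and the percept set $\mathcal{E}$ are finite; a percept is $e=(o,r)$ with reward $r\in[0,1]$. A history is $\ae_{<t}=a_1e_1\ldots a_{t-1}e_{t-1}\in(\mathcal{A}\times\mathcal{E})^*$. A policy maps each history to a distribution on $\mathcal{A}$; a deterministic policy is a map from histories to actions, and a history $\ae_{<t}$ is consistent with a deterministic $\pi$ if $a_k=\pi(\ae_{<k})$ for all $k<t$. A chronological contextual semimeasure $\nu$ assigns to all equal-length $e_{1:t}\in\mathcal{E}^t$, $a_{1:t}\in\mathcal{A}^t$ a number $\nu(e_{1:t}\,\|\,a_{1:t})\in[0,1]$ with $\nu(\epsilon\,\|\,\epsilon)\le1$ and $\sum_{e_t\in\mathcal{E}}\nu(e_{1:t}\,\|\,a_{1:t})\le\nu(e_{<t}\,\|\,a_{<t})$. It is lower semicomputable if $\{(e_{1:t},a_{1:t},q): q\in\mathbb{Q},\ \nu(e_{1:t}\,\|\,a_{1:t})>q\}$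 is recursively enumerable. A Bayesian mixture over $\mathcal{M}$ is $\xi(e_{1:t}\,\|\,a_{1:t})=\sum_{\nu\in\mathcal{M}}w(\nu)\,\nu(e_{1:t}\,\|\,a_{1:t})$ for a prior probability distribution $w$ on $\mathcal{M}$ with $w(\nu)>0$ for all $\nu\in\mathcal{M}$. The discount function $\gamma:\mathbb{N}\to\mathbb{R}_{\ge0}$ is computable and summable, $\Gamma_t:=\sum_{k\ge t}\gamma_k$. The value of policy $\pi$ in $\nu$ after a history with $\nu(e_{<t}\,\|\,a_{<t})>0$ is $$V^\pi_\nu(\ae_{<t})=\frac1{\Gamma_t}\sum_{k=t}^\infty\gamma_k\sum_{\ae_{t:k}}r_k\,\frac{\nu(e_{1:k}\,\|\,a_{1:k})}{\nu(e_{<t}\,\|\,a_{<t})}\prod_{i=t}^k\pi(a_i\mid\ae_{<i})$$ if $\Gamma_t>0$ and $0$ if $\Gamma_t=0$; $V^\pi_\nu(\ae_{<t}a)$ is the same expression with the action at time $t$ fixed to be $a$ (and $\pi$ used from time $t+1$ on). Optimal values are $V^*_\nu(\cdot)=\sup_\pi V^\pi_\nu(\cdot)$. *)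

theory Defs
  imports "HOL-Probability.Probability" "HOL-Library.Nat_Bijection" "HOL-Library.Countable"
begin

section \<open>Computability\<close>

text \<open>
  Kleene's partial recursive functions, presented as unary functions on the natural numbers
  with the (computable) Cantor pairing \<^const>\<open>prod_encode\<close> in place of several arguments.
  \<^term>\<open>None\<close> means that the computation diverges; all constructions are strict.
\<close>

definition minimise :: "(nat \<Rightarrow> nat option) \<Rightarrow> nat \<Rightarrow> nat option" where
  "minimise f a =
     (if \<exists>n. f (prod_encode (a, n)) = Some 0 \<and> (\<forall>m<n. f (prod_encode (a, m)) \<noteq> None)
      then Some (LEAST n. f (prod_encode (a, n)) = Some 0)
      else None)"

inductive partial_recursive :: "(nat \<Rightarrow> nat option) \<Rightarrow> bool" where
  zero: "partial_recursive (\<lambda>n. Some 0)"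
| succ: "partial_recursive (\<lambda>n. Some (Suc n))"
| left: "partial_recursive (\<lambda>n. Some (fst (prod_decode n)))"
| right: "partial_recursive (\<lambda>n. Some (snd (prod_decode n)))"
| pair: "partial_recursive f \<Longrightarrow> partial_recursive g \<Longrightarrow>
    partial_recursive
      (\<lambda>n. Option.bind (f n) (\<lambda>x. Option.bind (g n) (\<lambda>y. Some (prod_encode (x, y)))))"
| comp: "partial_recursive f \<Longrightarrow> partial_recursive g \<Longrightarrow>
    partial_recursive (\<lambda>n. Option.bind (g n) f)"
| prim_rec: "partial_recursive f \<Longrightarrow> partial_recursive g \<Longrightarrow>
    partial_recursive
      (\<lambda>n. rec_nat (f (fst (prod_decode n)))
             (\<lambda>k r. Option.bind r
                (\<lambda>y. g (prod_encode (fst (prod_decode n), prod_encode (k, y)))))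
             (snd (prod_decode n)))"
| minim: "partial_recursive f \<Longrightarrow> partial_recursive (minimise f)"

text \<open>
  Computability for other types is relative to an injective coding into the natural numbers.
  The codings used below have decidable range, so behaviour on non-codes is immaterial
  and is left unconstrained; \<open>recursively_enumerable code S\<close> is then the same as recursive
  enumerability of the set \<open>code ` S\<close> of natural numbers.
\<close>

definition computable_fun :: "('x \<Rightarrow> nat) \<Rightarrow> ('y \<Rightarrow> nat) \<Rightarrow> ('x \<Rightarrow> 'y) \<Rightarrow> bool" where
  "computable_fun cx cy F \<longleftrightarrow>
     (\<exists>f. partial_recursive f \<and> (\<forall>x. f (cx x) = Some (cy (F x))))"

definition recursively_enumerable :: "('x \<Rightarrow> nat) \<Rightarrow> 'x set \<Rightarrow> bool" where
  "recursively_enumerable code S \<longleftrightarrow>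
     (\<exists>f. partial_recursive f \<and> (\<forall>x. x \<in> S \<longleftrightarrow> f (code x) \<noteq> None))"

definition rat_code :: "rat \<Rightarrow> nat" where
  "rat_code q = prod_encode (int_encode (fst (quotient_of q)), int_encode (snd (quotient_of q)))"

definition lower_semicomputable :: "('x \<Rightarrow> nat) \<Rightarrow> ('x \<Rightarrow> real) \<Rightarrow> bool" where
  "lower_semicomputable code F \<longleftrightarrow>
     recursively_enumerable (\<lambda>(x, q). prod_encode (code x, rat_code q)) {(x, q). F x > of_rat q}"

text \<open>A real-valued function is computable iff it is approximable from below and from above.\<close>

definition computable_real_fun :: "('x \<Rightarrow> nat) \<Rightarrow> ('x \<Rightarrow> real) \<Rightarrow> bool" where
  "computable_real_fun code F \<longleftrightarrow>
     lower_semicomputable code F \<and> lower_semicomputable code (\<lambda>x. - F x)"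


section \<open>Histories, policies and environments\<close>

text \<open>
  The list \<open>[(a\<^sub>1, e\<^sub>1), \<dots>, (a\<^sub>n, e\<^sub>n)]\<close> is the history preceding time \<open>t = n + 1\<close>.
  Such lists are also exactly the pairs of equally long action and percept strings,
  so \<open>\<nu>(e\<^sub>1\<^sub>:\<^sub>n || a\<^sub>1\<^sub>:\<^sub>n)\<close> is written as \<open>\<nu>\<close> applied to that list.
  The percept set is the finite type \<open>'e\<close>; the reward component of a percept \<open>e = (o, r)\<close>
  is given by a function \<open>rew :: 'e \<Rightarrow> real\<close>.
\<close>

type_synonym ('a, 'e) history = "('a \<times> 'e) list"
type_synonym ('a, 'e) policy = "('a, 'e) history \<Rightarrow> 'a pmf"
type_synonym ('a, 'e) det_policy = "('a, 'e) history \<Rightarrow> 'a"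
type_synonym ('a, 'e) environment = "('a, 'e) history \<Rightarrow> real"

text \<open>
  On a finite type the choice of the injection \<^const>\<open>to_nat\<close> does not affect computability.
  It must not be used on histories themselves, where it would be an arbitrary, possibly
  non-computable, injection.
\<close>

definition history_code :: "('a::finite, 'e::finite) history \<Rightarrow> nat" where
  "history_code h = list_encode (map (\<lambda>(a, e). prod_encode (to_nat a, to_nat e)) h)"

definition computable_policy :: "('a::finite, 'e::finite) det_policy \<Rightarrow> bool" where
  "computable_policy \<pi> \<longleftrightarrow> computable_fun history_code to_nat \<pi>"

definition consistent :: "('a, 'e) det_policy \<Rightarrow> ('a, 'e) history \<Rightarrow> bool" where
  "consistent \<pi> h \<longleftrightarrow> (\<forall>k<length h. fst (h ! k) = \<pi> (take k h))"

definition stochastic :: "('a, 'e) det_policy \<Rightarrow> ('a, 'e) policy" where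
  "stochastic \<pi> = (\<lambda>h. return_pmf (\<pi> h))"

definition chronological_semimeasure :: "('a, 'e::finite) environment \<Rightarrow> bool" where
  "chronological_semimeasure \<nu> \<longleftrightarrow>
     (\<forall>h. 0 \<le> \<nu> h \<and> \<nu> h \<le> 1) \<and> (\<forall>h a. (\<Sum>e\<in>UNIV. \<nu> (h @ [(a, e)])) \<le> \<nu> h)"

definition lsc_semimeasures :: "('a::finite, 'e::finite) environment set" where
  "lsc_semimeasures = {\<nu>. chronological_semimeasure \<nu> \<and> lower_semicomputable history_code \<nu>}"

text \<open>Only the values of the prior on the class \<^const>\<open>lsc_semimeasures\<close> matter.\<close>

definition bayesian_mixture :: "('a::finite, 'e::finite) environment \<Rightarrow> bool" where
  "bayesian_mixture \<xi> \<longleftrightarrow>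
     (\<exists>w :: ('a, 'e) environment \<Rightarrow> real.
        (\<forall>\<nu>\<in>lsc_semimeasures. w \<nu> > 0) \<and>
        (w has_sum 1) lsc_semimeasures \<and>
        (\<forall>h. \<xi> h = (\<Sum>\<^sub>\<infinity>\<nu>\<in>lsc_semimeasures. w \<nu> * \<nu> h)))"


section \<open>Discounting and values\<close>

definition discount_function :: "(nat \<Rightarrow> real) \<Rightarrow> bool" where
  "discount_function \<gamma> \<longleftrightarrow> (\<forall>k. \<gamma> k \<ge> 0) \<and> computable_real_fun id \<gamma> \<and> summable \<gamma>"

definition discount_tail :: "(nat \<Rightarrow> real) \<Rightarrow> nat \<Rightarrow> real" where
  "discount_tail \<gamma> t = (\<Sum>i. \<gamma> (t + i))"

text \<open>
  Below \<open>h\<close> is the history before time \<open>t = length h + 1\<close>, the summation index \<open>j\<close> stands for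
  \<open>k - t\<close>, and \<open>z\<close> is the continuation from time \<open>t\<close> to time \<open>k\<close>, of length \<open>j + 1\<close>.
  Values are meaningful only if \<open>\<nu> h > 0\<close>. For \<open>\<nu> h = 0\<close> they are \<open>0\<close> because division by zero
  yields \<open>0\<close>; hence a strict lower bound \<open>\<epsilon> > 0\<close> on a value entails \<open>\<nu> h \<noteq> 0\<close>.
\<close>

definition policy_value ::
  "('e::finite \<Rightarrow> real) \<Rightarrow> (nat \<Rightarrow> real) \<Rightarrow> ('a::finite, 'e) environment \<Rightarrow> ('a, 'e) policy \<Rightarrow>
   ('a, 'e) history \<Rightarrow> real" where
  "policy_value rew \<gamma> \<nu> \<pi> h =
     (let t = length h + 1 in
      if discount_tail \<gamma> t > 0 then
        1 / discount_tail \<gamma> t *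
        (\<Sum>j. \<gamma> (t + j) *
           (\<Sum>z | length z = j + 1.
              rew (snd (z ! j)) * (\<nu> (h @ z) / \<nu> h) *
              (\<Prod>i\<in>{0..j}. pmf (\<pi> (h @ take i z)) (fst (z ! i)))))
      else 0)"

definition policy_action_value ::
  "('e::finite \<Rightarrow> real) \<Rightarrow> (nat \<Rightarrow> real) \<Rightarrow> ('a::finite, 'e) environment \<Rightarrow> ('a, 'e) policy \<Rightarrow>
   ('a, 'e) history \<Rightarrow> 'a \<Rightarrow> real" where
  "policy_action_value rew \<gamma> \<nu> \<pi> h a =
     (let t = length h + 1 in
      if discount_tail \<gamma> t > 0 then
        1 / discount_tail \<gamma> t *
        (\<Sum>j. \<gamma> (t + j) *
           (\<Sum>z | length z = j + 1 \<and> fst (z ! 0) = a.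
              rew (snd (z ! j)) * (\<nu> (h @ z) / \<nu> h) *
              (\<Prod>i\<in>{1..j}. pmf (\<pi> (h @ take i z)) (fst (z ! i)))))
      else 0)"

definition optimal_action_value ::
  "('e::finite \<Rightarrow> real) \<Rightarrow> (nat \<Rightarrow> real) \<Rightarrow> ('a::finite, 'e) environment \<Rightarrow>
   ('a, 'e) history \<Rightarrow> 'a \<Rightarrow> real" where
  "optimal_action_value rew \<gamma> \<nu> h a = (SUP \<pi>. policy_action_value rew \<gamma> \<nu> \<pi> h a)"

end

theory Submission
  imports Defs
begin

text \<open>
  Kill every environment \<open>\<nu>\<close> as soon as the agent deviates from \<open>\<pi>\<close>: the result \<open>\<rho>\<^sub>\<nu>\<close>, equal to
  \<open>\<nu>\<close> on histories consistent with \<open>\<pi>\<close> and to \<open>0\<close> elsewhere, is again a semimeasure, since a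
  semimeasure may lose mass, and it is lower semicomputable because consistency is decidable.
  Give \<open>\<nu>\<close> the weight \<open>d w(\<nu>) + (1 - d) w({\<mu>. \<rho>\<^sub>\<mu> = \<nu>})\<close> with \<open>d = min \<epsilon> (1/2)\<close>. The resulting
  mixture \<open>\<xi>'\<close> agrees with \<open>\<xi>\<close> on consistent histories and equals \<open>d \<xi>\<close> on all others. Following
  \<open>\<pi>\<close> thus still yields more than \<open>\<epsilon>\<close>, whereas a deviating action yields at most \<open>d \<le> \<epsilon>\<close>.
\<close>

section \<open>Recursive functions\<close>

definition total_recursive :: "(nat \<Rightarrow> nat) \<Rightarrow> bool" where
  "total_recursive f \<longleftrightarrow> partial_recursive (\<lambda>n. Some (f n))"

lemma partial_recursive_comp_total:
  assumes "partial_recursive F" "total_recursive g"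
  shows "partial_recursive (\<lambda>n. F (g n))"
  using partial_recursive.comp[of F "\<lambda>n. Some (g n)"] assms by (simp add: total_recursive_def)

named_theorems total_recursive_intros

lemma total_recursive_comp:
  assumes "total_recursive f" "total_recursive g"
  shows "total_recursive (\<lambda>n. f (g n))"
  using partial_recursive_comp_total[OF assms(1)[unfolded total_recursive_def] assms(2)]
  by (simp add: total_recursive_def)

lemma total_recursive_pair [total_recursive_intros]:
  assumes "total_recursive f" "total_recursive g"
  shows "total_recursive (\<lambda>n. prod_encode (f n, g n))"
  using partial_recursive.pair[of "\<lambda>n. Some (f n)" "\<lambda>n. Some (g n)"] assms
  by (simp add: total_recursive_def)

lemma total_recursive_fst [total_recursive_intros]:
  "total_recursive f \<Longrightarrow> total_recursive (\<lambda>n. fst (prod_decode (f n)))"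
  using total_recursive_comp[of "\<lambda>n. fst (prod_decode n)" f] partial_recursive.left
  by (simp add: total_recursive_def)

lemma total_recursive_snd [total_recursive_intros]:
  "total_recursive f \<Longrightarrow> total_recursive (\<lambda>n. snd (prod_decode (f n)))"
  using total_recursive_comp[of "\<lambda>n. snd (prod_decode n)" f] partial_recursive.right
  by (simp add: total_recursive_def)

lemma total_recursive_Suc [total_recursive_intros]:
  "total_recursive f \<Longrightarrow> total_recursive (\<lambda>n. Suc (f n))"
  using total_recursive_comp[of Suc f] partial_recursive.succ
  by (simp add: total_recursive_def)

text \<open>The identity is not among the generators; it arises by pairing the two projections of
  the same number.\<close>

lemma total_recursive_id [total_recursive_intros]: "total_recursive (\<lambda>n. n)"
  using partial_recursive.pair[OF partial_recursive.left partial_recursive.right]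
  by (simp add: total_recursive_def)

text \<open>Composition passes on only the result of the inner function. Pairing \<open>n\<close>
  with \<open>F n\<close> first lets \<open>g\<close> see the input as well.\<close>

lemma partial_recursive_map:
  assumes F: "partial_recursive F"
    and g: "total_recursive (\<lambda>q. g (fst (prod_decode q)) (snd (prod_decode q)))"
  shows "partial_recursive (\<lambda>n. Option.bind (F n) (\<lambda>y. Some (g n y)))"
proof -
  have "partial_recursive (\<lambda>n. Some n)"
    using total_recursive_id by (simp add: total_recursive_def)
  from partial_recursive.comp[OF g[unfolded total_recursive_def] partial_recursive.pair[OF this F]]
  have "partial_recursive (\<lambda>n. Option.bind (Option.bind (F n) (\<lambda>y. Some (prod_encode (n, y))))
      (\<lambda>q. Some (g (fst (prod_decode q)) (snd (prod_decode q)))))"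
    by simp
  moreover have "Option.bind (Option.bind (F n) (\<lambda>y. Some (prod_encode (n, y))))
      (\<lambda>q. Some (g (fst (prod_decode q)) (snd (prod_decode q)))) =
      Option.bind (F n) (\<lambda>y. Some (g n y))" for n
    by (cases "F n") auto
  ultimately show ?thesis by simp
qed

lemma total_recursive_const [total_recursive_intros]: "total_recursive (\<lambda>_. c)"
proof (induction c)
  case 0
  show ?case using partial_recursive.zero by (simp add: total_recursive_def)
next
  case (Suc c)
  then show ?case by (rule total_recursive_Suc)
qed

text \<open>With total data the strict recursion of \<open>prim_rec\<close> never meets
  \<open>None\<close>, so it is ordinary \<open>rec_nat\<close>. Substituting the pair of
  \<open>n\<close> and \<open>m n\<close> makes parameter and number of steps depend on one
  input.\<close>

lemma total_recursive_rec:
  assumes f: "total_recursive f" and m: "total_recursive m"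
    and g: "total_recursive (\<lambda>p. g (fst (prod_decode p)) (fst (prod_decode (snd (prod_decode p))))
              (snd (prod_decode (snd (prod_decode p)))))"
  shows "total_recursive (\<lambda>n. rec_nat (f n) (g n) (m n))"
proof -
  let ?g = "\<lambda>p. g (fst (prod_decode p)) (fst (prod_decode (snd (prod_decode p))))
              (snd (prod_decode (snd (prod_decode p))))"
  have eq: "rec_nat (Some x) (\<lambda>k r. Option.bind r (\<lambda>y. Some (h k y))) m = Some (rec_nat x h m)"
    for x h and m :: nat by (induction m) auto
  have "total_recursive (\<lambda>n. rec_nat (f (fst (prod_decode n))) (g (fst (prod_decode n)))
      (snd (prod_decode n)))"
    using partial_recursive.prim_rec[of "\<lambda>n. Some (f n)" "\<lambda>n. Some (?g n)"] f g
    by (simp add: total_recursive_def eq)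
  from total_recursive_comp[OF this total_recursive_pair[OF total_recursive_id m]]
  show ?thesis by simp
qed

text \<open>A case distinction is a recursion whose step ignores counter and accumulator.\<close>

lemma total_recursive_if [total_recursive_intros]:
  assumes "total_recursive x" "total_recursive f" "total_recursive g"
  shows "total_recursive (\<lambda>n. if x n = 0 then f n else g n)"
proof -
  have eq: "rec_nat a (\<lambda>_ _. b) m = (if m = 0 then a else b)" for a b and m :: nat
    by (cases m) auto
  show ?thesis
    using total_recursive_rec[OF assms(2,1), of "\<lambda>n _ _. g n"] assms(3)
      total_recursive_comp[OF assms(3) total_recursive_fst[OF total_recursive_id]]
    by (simp add: eq)
qed

lemma total_recursive_pred:
  assumes "total_recursive f"
  shows "total_recursive (\<lambda>n. f n - 1)"
proof -
  have eq: "rec_nat 0 (\<lambda>k _. k) m = m - 1" for m :: nat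
    by (cases m) auto
  have "total_recursive (\<lambda>n. rec_nat 0 (\<lambda>k _. k) (f n))"
    by (intro total_recursive_rec total_recursive_intros assms)
  then show ?thesis by (simp add: eq)
qed

lemma total_recursive_diff [total_recursive_intros]:
  assumes "total_recursive f" "total_recursive g"
  shows "total_recursive (\<lambda>n. f n - g n)"
proof -
  have eq: "rec_nat a (\<lambda>_ r. r - 1) m = a - m" for a and m :: nat
    by (induction m) auto
  have "total_recursive (\<lambda>n. rec_nat (f n) (\<lambda>_ r. r - 1) (g n))"
    by (intro total_recursive_rec total_recursive_pred total_recursive_intros assms)
  then show ?thesis by (simp only: eq)
qed

lemma total_recursive_mod2 [total_recursive_intros]:
  assumes "total_recursive f"
  shows "total_recursive (\<lambda>n. f n mod 2)"
proof -
  have eq: "rec_nat 0 (\<lambda>_ r. if r = 0 then 1 else 0) m = m mod 2" for m :: nat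
    by (induction m) (auto simp: mod_Suc)
  have "total_recursive (\<lambda>n. rec_nat 0 (\<lambda>_ r. if r = 0 then 1 else 0) (f n))"
    by (intro total_recursive_rec total_recursive_intros assms)
  then show ?thesis by (simp only: eq)
qed

lemma total_recursive_neq [total_recursive_intros]:
  assumes "total_recursive f" "total_recursive g"
  shows "total_recursive (\<lambda>n. of_bool (f n \<noteq> g n))"
proof -
  have "total_recursive (\<lambda>n. if f n - g n = 0 then if g n - f n = 0 then 0 else 1 else 1)"
    by (intro total_recursive_intros assms)
  moreover have "(\<lambda>n. if f n - g n = 0 then if g n - f n = 0 then 0 else 1 else 1)
      = (\<lambda>n. of_bool (f n \<noteq> g n) :: nat)" by (auto simp: fun_eq_iff)
  ultimately show ?thesis by simp
qed

text \<open>
  Lists are coded by iterated pairing at the front, so a prefix is only reachable by moving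
  elements onto an accumulator and reversing it again; the code of a list bounds its
  length, so \<open>rev_loop r r\<close> runs to the end.
\<close>

definition rev_loop :: "nat \<Rightarrow> nat \<Rightarrow> nat" where
  "rev_loop c k = rec_nat (prod_encode (c, 0))
     (\<lambda>_ y. if fst (prod_decode y) = 0 then y
        else prod_encode (snd (prod_decode (fst (prod_decode y) - 1)),
          Suc (prod_encode (fst (prod_decode (fst (prod_decode y) - 1)), snd (prod_decode y))))) k"

definition take_code :: "nat \<Rightarrow> nat \<Rightarrow> nat" where
  "take_code c k = (let r = snd (prod_decode (rev_loop c k)) in snd (prod_decode (rev_loop r r)))"

text \<open>A cons is coded as the successor of a pair, so each round moves one head to the
  accumulator. The empty list has code \<open>0\<close>, on which the loop idles, in agreement with
  \<open>drop\<close> and \<open>take\<close> beyond the length.\<close>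

lemma rev_loop_list_encode:
  "rev_loop (list_encode xs) k =
     prod_encode (list_encode (drop k xs), list_encode (rev (take k xs)))"
proof (induction k)
  case 0
  show ?case by (simp add: rev_loop_def)
next
  case (Suc k)
  show ?case
  proof (cases "k < length xs")
    case True
    have "rev_loop (list_encode xs) (Suc k) = prod_encode (list_encode (drop (Suc k) xs),
        list_encode (xs ! k # rev (take k xs)))"
      using Suc unfolding rev_loop_def by (simp add: Cons_nth_drop_Suc[OF True, symmetric])
    then show ?thesis by (simp add: take_Suc_conv_app_nth True)
  next
    case False
    then show ?thesis using Suc by (simp add: rev_loop_def)
  qed
qed

lemma length_le_list_encode: "length xs \<le> list_encode xs"
  by (induction xs) (auto intro: le_trans[OF _ le_prod_encode_2])

lemma take_code_list_encode: "take_code (list_encode xs) k = list_encode (take k xs)"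
  using length_le_list_encode[of "rev (take k xs)"]
  by (simp add: take_code_def rev_loop_list_encode Let_def)

lemma total_recursive_rev_loop [total_recursive_intros]:
  assumes "total_recursive f" "total_recursive g"
  shows "total_recursive (\<lambda>n. rev_loop (f n) (g n))"
  unfolding rev_loop_def
  by (intro total_recursive_rec total_recursive_intros assms)

lemma total_recursive_take_code [total_recursive_intros]:
  assumes "total_recursive f" "total_recursive g"
  shows "total_recursive (\<lambda>n. take_code (f n) (g n))"
  unfolding take_code_def Let_def by (intro total_recursive_intros assms)

section \<open>Deciding consistency with a computable policy\<close>

lemma history_code_take: "history_code (take k h) = take_code (history_code h) k"
  by (simp add: history_code_def take_code_list_encode take_map)

text \<open>A recursion over the positions records whether a violation has occurred. On a history
  code the policy is queried only on codes of prefixes, so every query halts.\<close>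

lemma partial_recursive_inconsistency:
  fixes \<pi> :: "('a::finite, 'e::finite) det_policy"
  assumes "computable_policy \<pi>"
  obtains F where "partial_recursive F"
    and "\<And>h. F (history_code h) = Some (of_bool (\<not> consistent \<pi> h))"
proof -
  obtain f where f: "partial_recursive f" "\<And>h. f (history_code h) = Some (to_nat (\<pi> h))"
    using assms by (auto simp: computable_policy_def computable_fun_def)
  \<comment> \<open>\<open>d\<close> codes the list from position \<open>k\<close> on, so
    \<open>d = 0\<close> means a position past the end, which is no violation. Otherwise
    \<open>d - 1\<close> is a pair whose first component codes the entry at
    \<open>k\<close>.\<close>
  define viol :: "nat \<Rightarrow> nat \<Rightarrow> nat \<Rightarrow> nat" where
    "viol c k v = (let d = fst (prod_decode (rev_loop c k)) in
       if d = 0 then 0 else of_bool (fst (prod_decode (fst (prod_decode (d - 1)))) \<noteq> v))" for c k v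
  \<comment> \<open>The argument codes the history, the position and the flag so far; a nonzero flag
    stays \<open>1\<close>.\<close>
  define G where "G = (\<lambda>p. Option.bind
     (f (take_code (fst (prod_decode p)) (fst (prod_decode (snd (prod_decode p))))))
     (\<lambda>v. Some (if snd (prod_decode (snd (prod_decode p))) = 0
        then viol (fst (prod_decode p)) (fst (prod_decode (snd (prod_decode p)))) v else 1)))"
  define F' where "F' = (\<lambda>n. rec_nat (Some 0)
             (\<lambda>k r. Option.bind r
                (\<lambda>y. G (prod_encode (fst (prod_decode n), prod_encode (k, y)))))
             (snd (prod_decode n)))"
  have "partial_recursive G"
    unfolding G_def viol_def Let_def
    by (intro partial_recursive_map partial_recursive_comp_total[OF f(1)] total_recursive_intros)
  then have "partial_recursive F'"
    unfolding F'_def by (intro partial_recursive.prim_rec partial_recursive.zero)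
  \<comment> \<open>The number of rounds is the history code itself, which is at least the length;
    surplus rounds find no violation.\<close>
  then have F: "partial_recursive (\<lambda>n. F' (prod_encode (n, n)))"
    by (rule partial_recursive_comp_total) (intro total_recursive_intros)
  have viol: "viol (history_code h) k v = of_bool (k < length h \<and> to_nat (fst (h ! k)) \<noteq> v)"
    for h :: "('a, 'e) history" and k v
  proof (cases "k < length h")
    case True
    have "drop k h = h ! k # drop (Suc k) h" by (simp add: Cons_nth_drop_Suc True)
    then show ?thesis
      using True
      by (simp add: viol_def history_code_def rev_loop_list_encode drop_map split: prod.split)
  next
    case False
    then show ?thesis
      by (simp add: viol_def history_code_def rev_loop_list_encode drop_map)
  qed
  have "F' (prod_encode (history_code h, m)) =
      Some (of_bool (\<exists>k<m. k < length h \<and> fst (h ! k) \<noteq> \<pi> (take k h)))"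
    for h :: "('a, 'e) history" and m
  proof (induction m)
    case 0
    show ?case by (simp add: F'_def)
  next
    case (Suc m)
    have "F' (prod_encode (history_code h, Suc m)) =
        Option.bind (F' (prod_encode (history_code h, m)))
          (\<lambda>y. G (prod_encode (history_code h, prod_encode (m, y))))"
      by (simp add: F'_def)
    moreover have "G (prod_encode (history_code h, prod_encode (m, y))) =
        Some (if y = 0 then of_bool (m < length h \<and> fst (h ! m) \<noteq> \<pi> (take m h)) else 1)" for y
      by (simp add: G_def history_code_take[symmetric] f viol)
    ultimately show ?case
      using Suc by (auto simp: less_Suc_eq)
  qed
  moreover have "length h \<le> history_code h" for h :: "('a, 'e) history"
    using length_le_list_encode unfolding history_code_def by (metis length_map)
  ultimately have "F' (prod_encode (history_code h, history_code h)) =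
      Some (of_bool (\<not> consistent \<pi> h))" for h :: "('a, 'e) history"
    by (auto simp: consistent_def) (meson order_less_le_trans)
  with F show thesis by (rule that)
qed

text \<open>\<open>int_encode\<close> gives negative integers odd codes and the others even codes,
  and the denominator of \<open>quotient_of\<close> is positive.\<close>

lemma rat_code_neg: "fst (prod_decode (rat_code q)) mod 2 = of_bool (q < 0)"
proof -
  have "q < 0 \<longleftrightarrow> fst (quotient_of q) < 0"
    using quotient_of_div[of q] quotient_of_denom_pos[of q]
    by (cases "quotient_of q") (auto simp: divide_less_0_iff)
  then show ?thesis
    by (auto simp: rat_code_def int_encode_def sum_encode_def)
qed

section \<open>Pruning an environment along a policy\<close>

definition prune :: "('a, 'e) det_policy \<Rightarrow> ('a, 'e) environment \<Rightarrow> ('a, 'e) environment" where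
  "prune \<pi> \<nu> h = (if consistent \<pi> h then \<nu> h else 0)"

lemma consistent_appendD: "consistent \<pi> (h @ z) \<Longrightarrow> consistent \<pi> h"
  unfolding consistent_def
proof (intro allI impI)
  fix k
  assume *: "\<forall>k<length (h @ z). fst ((h @ z) ! k) = \<pi> (take k (h @ z))" and k: "k < length h"
  from k have "k < length (h @ z)" by simp
  with * have "fst ((h @ z) ! k) = \<pi> (take k (h @ z))" by blast
  with k show "fst (h ! k) = \<pi> (take k h)" by (simp add: nth_append)
qed

text \<open>After a consistent history, dropping the deviating extensions can only decrease the sum;
  after an inconsistent one both sides are \<open>0\<close>.\<close>

lemma chronological_semimeasure_prune:
  fixes \<nu> :: "('a, 'e::finite) environment"
  assumes "chronological_semimeasure \<nu>"
  shows "chronological_semimeasure (prune \<pi> \<nu>)"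
proof -
  have "(\<Sum>e\<in>UNIV. prune \<pi> \<nu> (h @ [(a, e)])) \<le> prune \<pi> \<nu> h" for h :: "('a, 'e) history" and a
  proof (cases "consistent \<pi> h")
    case True
    have "(\<Sum>e\<in>UNIV. prune \<pi> \<nu> (h @ [(a, e)])) \<le> (\<Sum>e\<in>UNIV. \<nu> (h @ [(a, e)]))"
      using assms by (intro sum_mono) (auto simp: prune_def chronological_semimeasure_def)
    also have "\<dots> \<le> \<nu> h" using assms by (auto simp: chronological_semimeasure_def)
    finally show ?thesis using True by (simp add: prune_def)
  next
    case False
    then have "\<not> consistent \<pi> (h @ z)" for z
      using consistent_appendD by blast
    then show ?thesis using False by (simp add: prune_def)
  qed
  then show ?thesis using assms by (auto simp: chronological_semimeasure_def prune_def)
qed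

text \<open>A bound \<open>q < 0\<close> is always exceeded, by nonnegativity. For other
  \<open>q\<close> the pruned value exceeds \<open>q\<close> iff the history is consistent and
  \<open>\<nu> h\<close> exceeds \<open>q\<close>, so a decidable test is put in front of the
  procedure for \<nu>.\<close>

lemma lower_semicomputable_prune:
  fixes \<nu> :: "('a::finite, 'e::finite) environment"
  assumes \<pi>: "computable_policy \<pi>" and lsc: "lower_semicomputable history_code \<nu>"
    and nonneg: "\<And>h. 0 \<le> \<nu> h"
  shows "lower_semicomputable history_code (prune \<pi> \<nu>)"
proof -
  obtain F where F: "partial_recursive F"
    "\<And>h. F (history_code h) = Some (of_bool (\<not> consistent \<pi> h))"
    using partial_recursive_inconsistency[OF \<pi>] by metis
  obtain f where f: "partial_recursive f"
    "\<And>h q. \<nu> h > of_rat q \<longleftrightarrow> f (prod_encode (history_code h, rat_code q)) \<noteq> None"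
    using lsc by (auto simp: lower_semicomputable_def recursively_enumerable_def)
  \<comment> \<open>\<open>gate\<close> is \<open>0\<close> iff the history is consistent or \<open>q < 0\<close>, a negative numerator having an odd code;
    minimising a function that ignores the search variable then diverges unless \<open>gate\<close> is \<open>0\<close>.\<close>
  define gate where "gate = (\<lambda>n. Option.bind (F (fst (prod_decode n)))
      (\<lambda>y. Some (if y = 0 then 0 else 1 - fst (prod_decode (snd (prod_decode n))) mod 2)))"
  have gate: "partial_recursive gate"
    unfolding gate_def
    by (intro partial_recursive_map partial_recursive_comp_total[OF F(1)] total_recursive_intros)
  define stop where "stop = minimise (\<lambda>p. gate (fst (prod_decode p)))"
  have stop: "partial_recursive stop"
    unfolding stop_def
    by (intro partial_recursive.minim partial_recursive_comp_total[OF gate] total_recursive_intros)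
  have stop_iff: "stop n \<noteq> None \<longleftrightarrow> gate n = Some 0" for n
    by (auto simp: stop_def minimise_def)
  \<comment> \<open>Pairing is strict, so \<open>g\<close> halts exactly where both
    \<open>stop\<close> and \<open>f\<close> halt.\<close>
  define g where "g = (\<lambda>n. Option.bind (stop n) (\<lambda>x. Option.bind (f n) (\<lambda>y. Some (prod_encode (x, y)))))"
  have "partial_recursive g"
    unfolding g_def by (intro partial_recursive.pair stop f)
  moreover have "prune \<pi> \<nu> h > of_rat q \<longleftrightarrow> g (prod_encode (history_code h, rat_code q)) \<noteq> None"
    for h q
  proof -
    let ?n = "prod_encode (history_code h, rat_code q)"
    have neg: "of_rat q < \<nu> h" if "q < 0"
      using that nonneg[of h] of_rat_less_0_iff[of q, where ?'a = real] by linarith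
    have "g ?n \<noteq> None \<longleftrightarrow> gate ?n = Some 0 \<and> f ?n \<noteq> None"
      unfolding stop_iff[symmetric] by (cases "stop ?n"; cases "f ?n") (auto simp: g_def)
    also have "\<dots> \<longleftrightarrow> (consistent \<pi> h \<or> q < 0) \<and> of_rat q < \<nu> h"
      by (auto simp: gate_def F(2) rat_code_neg f(2))
    also have "\<dots> \<longleftrightarrow> prune \<pi> \<nu> h > of_rat q"
      using neg by (auto simp: prune_def)
    finally show ?thesis by simp
  qed
  ultimately show ?thesis
    by (auto simp: lower_semicomputable_def recursively_enumerable_def)
qed

section \<open>The reweighted mixture\<close>

text \<open>\<open>A\<close> is the disjoint union of the fibres of \<open>T\<close> over
  \<open>B\<close>; points of \<open>B\<close> outside the image have empty fibres.\<close>

lemma has_sum_fibres: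
  fixes f :: "'a \<Rightarrow> 'c :: {topological_comm_monoid_add, t3_space}" and g :: "'b \<Rightarrow> 'c"
  assumes f: "(f has_sum S) A" and T: "T ` A \<subseteq> B"
    and g: "\<And>y. y \<in> B \<Longrightarrow> (f has_sum g y) {x \<in> A. T x = y}"
  shows "(g has_sum S) B"
proof (rule has_sum_SigmaD)
  have "bij_betw snd (SIGMA y:B. {x \<in> A. T x = y}) A"
    using T by (intro bij_betwI[of _ _ _ "\<lambda>x. (T x, x)"]) auto
  then show "((\<lambda>p. f (snd p)) has_sum S) (SIGMA y:B. {x \<in> A. T x = y})"
    using f has_sum_reindex_bij_betw by blast
qed (use g in simp)

lemma has_sum_sum:
  fixes f :: "'i \<Rightarrow> 'a \<Rightarrow> 'b :: topological_comm_monoid_add"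
  assumes "\<And>i. i \<in> I \<Longrightarrow> (f i has_sum s i) A"
  shows "((\<lambda>x. \<Sum>i\<in>I. f i x) has_sum (\<Sum>i\<in>I. s i)) A"
  using assms by (induction I rule: infinite_finite_induct) (auto intro!: has_sum_add)

lemma lsc_semimeasuresD:
  assumes "\<nu> \<in> lsc_semimeasures"
  shows "0 \<le> \<nu> h" "\<nu> h \<le> 1" "(\<Sum>e\<in>UNIV. \<nu> (h @ [(a, e)])) \<le> \<nu> h"
  using assms by (auto simp: lsc_semimeasures_def chronological_semimeasure_def)

lemma weighted_summable_on:
  assumes "w summable_on lsc_semimeasures" "\<And>\<nu>. \<nu> \<in> lsc_semimeasures \<Longrightarrow> 0 < w \<nu>"
  shows "(\<lambda>\<nu>. w \<nu> * \<nu> h) summable_on lsc_semimeasures"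
  using assms
  by (intro summable_on_comparison_test[OF assms(1)])
     (auto simp: lsc_semimeasuresD mult_left_le less_imp_le)

lemma prune_in_lsc_semimeasures:
  fixes \<nu> :: "('a::finite, 'e::finite) environment"
  assumes "computable_policy \<pi>" "\<nu> \<in> lsc_semimeasures"
  shows "prune \<pi> \<nu> \<in> lsc_semimeasures"
  using assms lower_semicomputable_prune[OF assms(1)] lsc_semimeasuresD(1)[OF assms(2)]
  by (simp add: lsc_semimeasures_def chronological_semimeasure_prune)

text \<open>\<open>infsum\<close> defaults to \<open>0\<close> on divergent families, so convergence
  is made explicit; it follows by domination by the prior.\<close>

lemma bayesian_mixtureE:
  fixes \<xi> :: "('a::finite, 'e::finite) environment"
  assumes "bayesian_mixture \<xi>"
  obtains w :: "('a, 'e) environment \<Rightarrow> real"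
  where "\<And>\<nu>. \<nu> \<in> lsc_semimeasures \<Longrightarrow> 0 < w \<nu>" "(w has_sum 1) lsc_semimeasures"
    and "\<And>h. ((\<lambda>\<nu>. w \<nu> * \<nu> h) has_sum \<xi> h) lsc_semimeasures"
proof -
  obtain w :: "('a, 'e) environment \<Rightarrow> real"
    where w: "\<And>\<nu>. \<nu> \<in> lsc_semimeasures \<Longrightarrow> 0 < w \<nu>" "(w has_sum 1) lsc_semimeasures"
    and \<xi>: "\<And>h. \<xi> h = (\<Sum>\<^sub>\<infinity>\<nu>\<in>lsc_semimeasures. w \<nu> * \<nu> h)"
    using assms unfolding bayesian_mixture_def by blast
  have "((\<lambda>\<nu>. w \<nu> * \<nu> h) has_sum \<xi> h) lsc_semimeasures" for h
    unfolding \<xi>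
    by (rule has_sum_infsum[OF weighted_summable_on[OF has_sum_imp_summable[OF w(2)] w(1)]])
  with w show thesis by (rule that)
qed

lemma bayesian_mixture_chronological:
  fixes \<xi> :: "('a::finite, 'e::finite) environment"
  assumes "bayesian_mixture \<xi>"
  shows "chronological_semimeasure \<xi>"
proof -
  obtain w where w: "\<And>\<nu>. \<nu> \<in> lsc_semimeasures \<Longrightarrow> 0 < w \<nu>" "(w has_sum 1) lsc_semimeasures"
    and sum: "\<And>h. ((\<lambda>\<nu>. w \<nu> * \<nu> h) has_sum \<xi> h) lsc_semimeasures"
    using bayesian_mixtureE[OF assms] by blast
  have "0 \<le> \<xi> h" for h
    by (rule has_sum_nonneg[OF sum]) (simp add: lsc_semimeasuresD w(1) less_imp_le)
  moreover have "\<xi> h \<le> 1" for h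
    by (rule has_sum_mono[OF sum w(2)]) (simp add: lsc_semimeasuresD w(1) mult_left_le less_imp_le)
  moreover have "(\<Sum>e\<in>UNIV. \<xi> (h @ [(a, e)])) \<le> \<xi> h" for h a
  proof (rule has_sum_mono[OF has_sum_sum[OF sum] sum])
    show "(\<Sum>e\<in>UNIV. w \<nu> * \<nu> (h @ [(a, e)])) \<le> w \<nu> * \<nu> h" if "\<nu> \<in> lsc_semimeasures" for \<nu>
      using lsc_semimeasuresD(3)[OF that] w(1)[OF that]
      by (simp flip: sum_distrib_left)
  qed
  ultimately show ?thesis by (simp add: chronological_semimeasure_def)
qed

text \<open>The push-forward \<open>v\<close> of the prior \<open>w\<close> under pruning is a
  probability distribution with mixture \<open>prune \<pi> \<xi>\<close>. It vanishes outside the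
  image of pruning, so a share \<open>d\<close> of \<open>w\<close> is kept to make the new prior
  positive everywhere.\<close>

lemma bayesian_mixture_prune:
  fixes \<xi> :: "('a::finite, 'e::finite) environment"
  assumes \<pi>: "computable_policy \<pi>" and "bayesian_mixture \<xi>" and d: "0 < d" "d < 1"
  shows "bayesian_mixture (\<lambda>h. d * \<xi> h + (1 - d) * prune \<pi> \<xi> h)"
proof -
  obtain w where w: "\<And>\<nu>. \<nu> \<in> lsc_semimeasures \<Longrightarrow> 0 < w \<nu>" "(w has_sum 1) lsc_semimeasures"
    and sum: "\<And>h. ((\<lambda>\<nu>. w \<nu> * \<nu> h) has_sum \<xi> h) lsc_semimeasures"
    using bayesian_mixtureE[OF assms(2)] by blast
  let ?fib = "\<lambda>\<nu>. {\<mu> \<in> lsc_semimeasures. prune \<pi> \<mu> = \<nu>}"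
  define v where "v \<nu> = infsum w (?fib \<nu>)" for \<nu>
  have v: "(w has_sum v \<nu>) (?fib \<nu>)" for \<nu>
    unfolding v_def by (rule has_sum_infsum[OF summable_on_subset[OF has_sum_imp_summable[OF w(2)]]]) auto
  have v_nonneg: "0 \<le> v \<nu>" for \<nu>
    by (rule has_sum_nonneg[OF v]) (simp add: w(1) less_imp_le)
  have T: "prune \<pi> ` lsc_semimeasures \<subseteq> (lsc_semimeasures :: ('a, 'e) environment set)"
    using prune_in_lsc_semimeasures[OF \<pi>] by auto
  have v1: "(v has_sum 1) lsc_semimeasures"
    by (rule has_sum_fibres[OF w(2) T v])
  \<comment> \<open>For fixed \<open>h\<close>, pruning multiplies every environment by the same
    factor, \<open>0\<close> or \<open>1\<close>.\<close>
  have pr: "((\<lambda>\<nu>. w \<nu> * prune \<pi> \<nu> h) has_sum prune \<pi> \<xi> h) lsc_semimeasures" for h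
    using sum[of h] by (simp add: prune_def)
  have vpr: "((\<lambda>\<nu>. v \<nu> * \<nu> h) has_sum prune \<pi> \<xi> h) lsc_semimeasures" for h
  proof (rule has_sum_fibres[OF pr T])
    fix \<nu> :: "('a, 'e) environment"
    \<comment> \<open>On the fibre the pruned value at \<open>h\<close> is the constant
      \<open>\<nu> h\<close>, which factors out.\<close>
    show "((\<lambda>\<mu>. w \<mu> * prune \<pi> \<mu> h) has_sum v \<nu> * \<nu> h) (?fib \<nu>)"
      using has_sum_cmult_left[OF v[of \<nu>], of "\<nu> h"]
      by (rule has_sum_cong[THEN iffD1, rotated]) simp
  qed
  show ?thesis
    unfolding bayesian_mixture_def
  proof (intro exI[of _ "\<lambda>\<nu>. d * w \<nu> + (1 - d) * v \<nu>"] conjI allI ballI)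
    fix \<nu> :: "('a, 'e) environment"
    assume "\<nu> \<in> lsc_semimeasures"
    then show "0 < d * w \<nu> + (1 - d) * v \<nu>"
      using d w(1) v_nonneg by (intro add_pos_nonneg) auto
  next
    show "((\<lambda>\<nu>. d * w \<nu> + (1 - d) * v \<nu>) has_sum 1) lsc_semimeasures"
      using has_sum_add[OF has_sum_cmult_right[OF w(2), of d] has_sum_cmult_right[OF v1, of "1 - d"]]
      by simp
  next
    fix h
    show "d * \<xi> h + (1 - d) * prune \<pi> \<xi> h =
        (\<Sum>\<^sub>\<infinity>\<nu>\<in>lsc_semimeasures. (d * w \<nu> + (1 - d) * v \<nu>) * \<nu> h)"
      using has_sum_add[OF has_sum_cmult_right[OF sum[of h], of d] has_sum_cmult_right[OF vpr[of h], of "1 - d"]]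
      by (intro infsumI[symmetric]) (simp add: algebra_simps)
  qed
qed

section \<open>Values\<close>

text \<open>Induction on the last time step: summing out the last percept uses the semimeasure
  inequality, and the probabilities of the last action add up to \<open>1\<close>. The first action
  is fixed and carries no policy factor, hence the product from \<open>1\<close>.\<close>

lemma sum_histories_le:
  fixes \<nu> :: "('a::finite, 'e::finite) environment"
  assumes \<nu>: "chronological_semimeasure \<nu>"
  shows "(\<Sum>z | length z = j + 1 \<and> fst (z ! 0) = a.
      \<nu> (h @ z) * (\<Prod>i\<in>{1..j}. pmf (\<pi> (h @ take i z)) (fst (z ! i)))) \<le> \<nu> h"
proof (induction j)
  case 0
  have "bij_betw (\<lambda>e. [(a, e)]) (UNIV :: 'e set) {z. length z = 0 + 1 \<and> fst (z ! 0) = a}"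
    by (intro bij_betwI[of _ _ _ "\<lambda>z. snd (z ! 0)"]) (auto simp: length_Suc_conv)
  from sum.reindex_bij_betw[OF this, of "\<lambda>z. \<nu> (h @ z)"] show ?case
    using \<nu> by (simp add: chronological_semimeasure_def) metis
next
  case (Suc j)
  let ?A = "\<lambda>j. {z :: ('a, 'e) history. length z = j + 1 \<and> fst (z ! 0) = a}"
  let ?p = "\<lambda>j z. \<Prod>i\<in>{1..j}. pmf (\<pi> (h @ take i z)) (fst (z ! i))"
  have fin: "finite (?A n)" for n
    by (rule finite_subset[OF _ finite_lists_length_eq[OF finite, where n = "n + 1"]]) auto
  have bij: "bij_betw (\<lambda>(z, p). z @ [p]) (?A j \<times> UNIV) (?A (Suc j))"
  proof (intro bij_betwI[of _ _ _ "\<lambda>z. (butlast z, last z)"])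
    show "(\<lambda>z. (butlast z, last z)) \<in> ?A (Suc j) \<rightarrow> ?A j \<times> UNIV"
      by (auto simp: nth_butlast)
  next
    show "(case (butlast z, last z) of (z, p) \<Rightarrow> z @ [p]) = z" if "z \<in> ?A (Suc j)" for z
      using that by (auto intro!: append_butlast_last_id)
  qed (auto simp: nth_append)
  have step: "?p (Suc j) (z @ [p]) = ?p j z * pmf (\<pi> (h @ z)) (fst p)" if "z \<in> ?A j" for z p
    using that by (auto simp: nth_append intro!: prod.cong)
  have "(\<Sum>z\<in>?A (Suc j). \<nu> (h @ z) * ?p (Suc j) z) =
      (\<Sum>(z, p)\<in>?A j \<times> UNIV. \<nu> (h @ z @ [p]) * ?p (Suc j) (z @ [p]))"
    using sum.reindex_bij_betw[OF bij, of "\<lambda>z. \<nu> (h @ z) * ?p (Suc j) z"]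
    by (simp add: case_prod_beta)
  also have "\<dots> = (\<Sum>z\<in>?A j. \<Sum>p\<in>UNIV. \<nu> (h @ z @ [p]) * ?p (Suc j) (z @ [p]))"
    by (rule sum.cartesian_product[symmetric])
  also have "\<dots> \<le> (\<Sum>z\<in>?A j. \<nu> (h @ z) * ?p j z)"
  proof (rule sum_mono)
    fix z
    assume z: "z \<in> ?A j"
    let ?q = "\<lambda>b. pmf (\<pi> (h @ z)) b"
    have "(\<Sum>p\<in>UNIV. \<nu> (h @ z @ [p]) * ?p (Suc j) (z @ [p])) =
        (\<Sum>p\<in>UNIV. ?p j z * (?q (fst p) * \<nu> ((h @ z) @ [p])))"
      by (intro sum.cong refl) (simp only: step[OF z] append_assoc mult.assoc mult.commute mult.left_commute)
    \<comment> \<open>The last pair is split into its action \<open>b\<close> and its percept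
      \<open>e\<close>.\<close>
    also have "\<dots> = ?p j z * (\<Sum>b\<in>UNIV. ?q b * (\<Sum>e\<in>UNIV. \<nu> ((h @ z) @ [(b, e)])))"
      by (simp add: sum_distrib_left sum.cartesian_product case_prod_beta)
    also have "\<dots> \<le> ?p j z * (\<Sum>b\<in>UNIV. ?q b * \<nu> (h @ z))"
      using \<nu> unfolding chronological_semimeasure_def
      by (intro mult_left_mono sum_mono prod_nonneg) (auto simp del: append_assoc)
    also have "\<dots> = \<nu> (h @ z) * ?p j z"
      by (simp add: sum_distrib_right[symmetric] sum_pmf_eq_1)
    finally show "(\<Sum>p\<in>UNIV. \<nu> (h @ z @ [p]) * ?p (Suc j) (z @ [p])) \<le> \<nu> (h @ z) * ?p j z" .
  qed
  also have "\<dots> \<le> \<nu> h" by (rule Suc)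
  finally show ?case .
qed

definition expected_reward where
  "expected_reward rew \<nu> \<pi> h a j = (\<Sum>z | length z = j + 1 \<and> fst (z ! 0) = a.
      rew (snd (z ! j)) * (\<nu> (h @ z) / \<nu> h) *
      (\<Prod>i\<in>{1..j}. pmf (\<pi> (h @ take i z)) (fst (z ! i))))"

lemma policy_action_value_altdef:
  "policy_action_value rew \<gamma> \<nu> \<pi> h a =
     (let t = length h + 1 in
      if discount_tail \<gamma> t > 0 then
        1 / discount_tail \<gamma> t * (\<Sum>j. \<gamma> (t + j) * expected_reward rew \<nu> \<pi> h a j)
      else 0)"
  by (simp add: policy_action_value_def expected_reward_def)

lemma expected_reward_bounds:
  fixes \<nu> :: "('a::finite, 'e::finite) environment"
  assumes rew: "\<forall>e. 0 \<le> rew e \<and> rew e \<le> 1" and \<nu>: "chronological_semimeasure \<nu>"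
  shows "0 \<le> expected_reward rew \<nu> \<pi> h a j" "expected_reward rew \<nu> \<pi> h a j \<le> 1"
proof -
  have nn: "0 \<le> \<nu> h" for h using \<nu> by (simp add: chronological_semimeasure_def)
  show "0 \<le> expected_reward rew \<nu> \<pi> h a j"
    unfolding expected_reward_def using rew nn
    by (intro sum_nonneg mult_nonneg_nonneg divide_nonneg_nonneg prod_nonneg) auto
  let ?q = "\<lambda>z. \<Prod>i\<in>{1..j}. pmf (\<pi> (h @ take i z)) (fst (z ! i))"
  have "expected_reward rew \<nu> \<pi> h a j \<le>
      (\<Sum>z | length z = j + 1 \<and> fst (z ! 0) = a. \<nu> (h @ z) / \<nu> h * ?q z)"
    unfolding expected_reward_def using rew nn
    by (intro sum_mono mult_right_mono mult_left_le_one_le divide_nonneg_nonneg prod_nonneg) auto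
  also have "\<dots> = (\<Sum>z | length z = j + 1 \<and> fst (z ! 0) = a. \<nu> (h @ z) * ?q z) / \<nu> h"
    by (simp add: sum_divide_distrib)
  \<comment> \<open>If \<open>\<nu> h = 0\<close>, the quotient is \<open>0\<close> by convention
    and the bound still holds.\<close>
  also have "\<dots> \<le> 1"
    using sum_histories_le[OF \<nu>, where j = j and a = a and h = h and \<pi> = \<pi>] nn[of h]
    by (auto simp: divide_le_eq_1)
  finally show "expected_reward rew \<nu> \<pi> h a j \<le> 1" .
qed

text \<open>Both claims come from termwise comparison with the discount; the resulting bound
  \<open>discount_tail\<close> cancels against the normalisation.\<close>

lemma
  fixes \<nu> :: "('a::finite, 'e::finite) environment"
  assumes rew: "\<forall>e. 0 \<le> rew e \<and> rew e \<le> 1" and \<nu>: "chronological_semimeasure \<nu>"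
    and \<gamma>: "\<And>k. 0 \<le> \<gamma> k" "summable \<gamma>"
  shows summable_expected_reward: "summable (\<lambda>j. \<gamma> (t + j) * expected_reward rew \<nu> \<pi> h a j)"
    and policy_action_value_le_1: "policy_action_value rew \<gamma> \<nu> \<pi> h a \<le> 1"
proof -
  note bounds = expected_reward_bounds[OF rew \<nu>]
  have \<gamma>': "summable (\<lambda>j. \<gamma> (t + j))" for t
    using summable_iff_shift[of \<gamma> t] \<gamma>(2) by (simp add: add.commute)
  have le: "\<gamma> (t + j) * expected_reward rew \<nu> \<pi> h a j \<le> \<gamma> (t + j)" for t j
    using bounds \<gamma>(1) by (intro mult_left_le) auto
  show s: "summable (\<lambda>j. \<gamma> (t + j) * expected_reward rew \<nu> \<pi> h a j)" for t
    using bounds \<gamma>(1) le by (intro summable_comparison_test'[OF \<gamma>', of 0]) auto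
  show "policy_action_value rew \<gamma> \<nu> \<pi> h a \<le> 1"
    using suminf_le[OF le s \<gamma>', of "length h + 1"]
    by (auto simp: policy_action_value_altdef Let_def discount_tail_def)
qed

text \<open>A real supremum is an upper bound only for families bounded above; here \<open>1\<close>
  is a bound.\<close>

lemma policy_action_value_le_optimal:
  fixes \<nu> :: "('a::finite, 'e::finite) environment"
  assumes "\<forall>e. 0 \<le> rew e \<and> rew e \<le> 1" "chronological_semimeasure \<nu>"
    and "\<And>k. 0 \<le> \<gamma> k" "summable \<gamma>"
  shows "policy_action_value rew \<gamma> \<nu> \<pi> h a \<le> optimal_action_value rew \<gamma> \<nu> h a"
  unfolding optimal_action_value_def
  using policy_action_value_le_1[OF assms] by (intro cSUP_upper bdd_aboveI2) auto

section \<open>Values of following the policy and of deviating from it\<close>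

lemma consistent_snoc: "consistent \<pi> (h @ [(a, e)]) \<longleftrightarrow> consistent \<pi> h \<and> a = \<pi> h"
  by (auto simp: consistent_def nth_append less_Suc_eq)

lemma consistent_append_iff:
  "consistent \<pi> (h @ z) \<longleftrightarrow> consistent \<pi> h \<and> (\<forall>i<length z. fst (z ! i) = \<pi> (h @ take i z))"
proof (induction z rule: rev_induct)
  case (snoc p z)
  then show ?case
    using consistent_snoc[of \<pi> "h @ z" "fst p" "snd p"]
    by (auto simp: nth_append less_Suc_eq)
qed simp

text \<open>A continuation that leaves \<pi> has a vanishing policy factor, and on the others the
  two environments agree. The factor for the first action, absent on the left, is
  \<open>1\<close>.\<close>

lemma policy_action_value_stochastic:
  fixes \<nu> \<nu>' :: "('a::finite, 'e::finite) environment"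
  assumes eq: "\<And>h. consistent \<pi> h \<Longrightarrow> \<nu>' h = \<nu> h" and h: "consistent \<pi> h"
  shows "policy_action_value rew \<gamma> \<nu>' (stochastic \<pi>) h (\<pi> h) =
    policy_value rew \<gamma> \<nu> (stochastic \<pi>) h"
proof -
  have "(\<Sum>z | length z = j + 1 \<and> fst (z ! 0) = \<pi> h. rew (snd (z ! j)) * (\<nu>' (h @ z) / \<nu>' h) *
          (\<Prod>i\<in>{1..j}. pmf (stochastic \<pi> (h @ take i z)) (fst (z ! i)))) =
      (\<Sum>z | length z = j + 1. rew (snd (z ! j)) * (\<nu> (h @ z) / \<nu> h) *
          (\<Prod>i\<in>{0..j}. pmf (stochastic \<pi> (h @ take i z)) (fst (z ! i))))" for j
  proof (rule sum.mono_neutral_cong_left)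
    show "finite {z :: ('a, 'e) history. length z = j + 1}"
      using finite_lists_length_eq[OF finite[of UNIV], of "j + 1"] by simp
  next
    \<comment> \<open>A different first action makes the factor at \<open>i = 0\<close>
      vanish.\<close>
    show "\<forall>z\<in>{z. length z = j + 1} - {z. length z = j + 1 \<and> fst (z ! 0) = \<pi> h}.
        rew (snd (z ! j)) * (\<nu> (h @ z) / \<nu> h) *
          (\<Prod>i\<in>{0..j}. pmf (stochastic \<pi> (h @ take i z)) (fst (z ! i))) = 0"
      by (auto simp: stochastic_def indicator_def intro!: bexI[of _ 0] split: if_splits)
  next
    fix z :: "('a, 'e) history"
    assume z: "z \<in> {z. length z = j + 1 \<and> fst (z ! 0) = \<pi> h}"
    let ?q = "\<lambda>i. pmf (stochastic \<pi> (h @ take i z)) (fst (z ! i))"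
    have prod: "prod ?q {0..j} = prod ?q {1..j}"
      using z by (simp add: prod.atLeast_Suc_atMost stochastic_def)
    show "rew (snd (z ! j)) * (\<nu>' (h @ z) / \<nu>' h) * prod ?q {1..j} =
        rew (snd (z ! j)) * (\<nu> (h @ z) / \<nu> h) * prod ?q {0..j}"
    proof (cases "consistent \<pi> (h @ z)")
      case True
      then show ?thesis using eq h prod by simp
    next
      case False
      then obtain i where "i \<le> j" "fst (z ! i) \<noteq> \<pi> (h @ take i z)"
        using h z by (auto simp: consistent_append_iff less_Suc_eq_le)
      then have "prod ?q {0..j} = 0"
        by (auto simp: stochastic_def intro!: bexI[of _ i])
      moreover from this have "prod ?q {1..j} = 0"
        by (simp only: prod)
      ultimately show ?thesis by (simp only: mult_zero_right)
    qed
  qed auto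
  then show ?thesis
    by (simp add: policy_action_value_def policy_value_def)
qed

text \<open>The numerators scale by \<open>d\<close> while the denominator \<open>\<nu> h\<close>
  stays the same. Summability allows \<open>d\<close> to be pulled out of the series.\<close>

lemma policy_action_value_scaled:
  fixes \<nu> \<nu>' :: "('a::finite, 'e::finite) environment"
  assumes rew: "\<forall>e. 0 \<le> rew e \<and> rew e \<le> 1" and \<nu>: "chronological_semimeasure \<nu>"
    and \<gamma>: "\<And>k. 0 \<le> \<gamma> k" "summable \<gamma>"
    and eq: "\<nu>' h = \<nu> h" "\<And>e z. \<nu>' (h @ (a, e) # z) = d * \<nu> (h @ (a, e) # z)"
  shows "policy_action_value rew \<gamma> \<nu>' \<pi> h a = d * policy_action_value rew \<gamma> \<nu> \<pi> h a"
proof -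
  have "\<nu>' (h @ z) = d * \<nu> (h @ z)" if "length z = j + 1" "fst (z ! 0) = a" for z and j :: nat
    using that eq(2) by (cases z) auto
  then have "expected_reward rew \<nu>' \<pi> h a j = d * expected_reward rew \<nu> \<pi> h a j" for j
    unfolding expected_reward_def sum_distrib_left
    by (intro sum.cong refl) (auto simp: eq(1))
  then show ?thesis
    using suminf_mult[OF summable_expected_reward[OF rew \<nu> \<gamma>], of d "length h + 1"]
    by (simp add: policy_action_value_altdef Let_def mult.left_commute)
qed

theorem theorem5p5:
  fixes rew :: "'e::finite \<Rightarrow> real"
    and \<gamma> :: "nat \<Rightarrow> real"
    and \<pi> :: "('a::finite, 'e) det_policy"
    and \<xi> :: "('a, 'e) environment"
    and \<epsilon> :: real
  assumes "\<forall>e. 0 \<le> rew e \<and> rew e \<le> 1"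
    and "discount_function \<gamma>"
    and "computable_policy \<pi>"
    and "bayesian_mixture \<xi>"
    and "\<epsilon> > 0"
  shows "\<exists>\<xi>' :: ('a, 'e) environment. bayesian_mixture \<xi>' \<and>
    (\<forall>h. consistent \<pi> h \<and> policy_value rew \<gamma> \<xi> (stochastic \<pi>) h > \<epsilon> \<longrightarrow>
       (\<forall>b. b \<noteq> \<pi> h \<longrightarrow>
          optimal_action_value rew \<gamma> \<xi>' h (\<pi> h) > optimal_action_value rew \<gamma> \<xi>' h b))"
proof -
  \<comment> \<open>The cap \<open>1/2\<close> keeps \<open>1 - d\<close> positive when \<epsilon>
    is large.\<close>
  define d where "d = min \<epsilon> (1/2)"
  have d: "0 < d" "d < 1" "d \<le> \<epsilon>" using assms(5) by (auto simp: d_def)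
  define \<xi>' where "\<xi>' = (\<lambda>h. d * \<xi> h + (1 - d) * prune \<pi> \<xi> h)"
  have mix: "bayesian_mixture \<xi>'"
    unfolding \<xi>'_def by (rule bayesian_mixture_prune) (use assms d in auto)
  have \<gamma>: "\<And>k. 0 \<le> \<gamma> k" "summable \<gamma>" using assms(2) by (auto simp: discount_function_def)
  note \<xi> = bayesian_mixture_chronological[OF assms(4)]
  have eq: "\<xi>' h = \<xi> h" if "consistent \<pi> h" for h
    using that by (simp add: \<xi>'_def prune_def algebra_simps)
  have "optimal_action_value rew \<gamma> \<xi>' h b < optimal_action_value rew \<gamma> \<xi>' h (\<pi> h)"
    if h: "consistent \<pi> h" "policy_value rew \<gamma> \<xi> (stochastic \<pi>) h > \<epsilon>" "b \<noteq> \<pi> h" for h b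
  proof -
    \<comment> \<open>Every continuation starting with \<open>b\<close> is inconsistent, so the
      pruned part contributes nothing.\<close>
    have "\<xi>' (h @ (b, e) # z) = d * \<xi> (h @ (b, e) # z)" for e z
      using h(3) by (auto simp: \<xi>'_def prune_def consistent_append_iff)
    then have "policy_action_value rew \<gamma> \<xi>' \<pi>' h b = d * policy_action_value rew \<gamma> \<xi> \<pi>' h b" for \<pi>'
      by (intro policy_action_value_scaled assms(1) \<xi> \<gamma> eq h(1))
    then have "policy_action_value rew \<gamma> \<xi>' \<pi>' h b \<le> d" for \<pi>'
      using policy_action_value_le_1[OF assms(1) \<xi> \<gamma>] d by (simp add: mult_left_le)
    \<comment> \<open>The bound is uniform in the policy and so passes to the supremum.\<close>
    then have "optimal_action_value rew \<gamma> \<xi>' h b \<le> d"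
      unfolding optimal_action_value_def by (intro cSUP_least) auto
    also have "d \<le> \<epsilon>" by (rule d)
    also have "\<epsilon> < policy_value rew \<gamma> \<xi> (stochastic \<pi>) h" by (rule h)
    also have "\<dots> = policy_action_value rew \<gamma> \<xi>' (stochastic \<pi>) h (\<pi> h)"
      using policy_action_value_stochastic[of \<pi> \<xi>' \<xi>] eq h(1) by simp
    also have "\<dots> \<le> optimal_action_value rew \<gamma> \<xi>' h (\<pi> h)"
      using policy_action_value_le_optimal[OF assms(1) bayesian_mixture_chronological[OF mix] \<gamma>] .
    finally show ?thesis .
  qed
  with mix show ?thesis by blast
qed

end
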